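(* Let $M=(m_{ij})$ be a real symmetric $d\times d$ matrix, let $\mathbf{z}_1,\dots,\mathbf{z}_N$ be independent random vectors in $\mathbb{R}^d$, each with i.i.d. Rademacher entries, let $\mathbf{z}$ denote a vector with the same distribution, and let $\hat T=\frac1N\sum_{i=1}^N\mathbf{z}_i^{\mathsf T}M\mathbf{z}_i$. Then $$\operatorname{Var}(\hat T)=\frac1N\operatorname{Var}(\mathbf{z}^{\mathsf T}M\mathbf{z})=\frac2N\sum_{i\ne j}m_{ij}^2\;\le\;\frac{2\|M\|_F^2}{N}.$$ In particular, for fixed $M$ with $\operatorname{tr}(M)\neq 0$, the relative standard error of $\hat T/d$ as an estimator of $\operatorname{tr}(M)/d$, i.e. $\sqrt{\operatorname{Var}(\hat T/d)}\,/\,|\operatorname{tr}(M)/d|$, is $O(1/\sqrt N)$ as $N\to\infty$.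
   Context: A Rademacher variable equals $+1$ or $-1$ with probability $1/2$ each. $\|\cdot\|_F$ is the Frobenius norm; the sum over $i\ne j$ runs over ordered pairs. $\hat T$ is the Hutchinson estimator of $\operatorname{tr}(M)$ with $N$ probes. *)

theory Defs
  imports "HOL-Probability.Probability" "HOL-Library.Landau_Symbols"
begin

definition (in prob_space) rademacher :: "('a \<Rightarrow> real) \<Rightarrow> bool" where
  "rademacher X \<longleftrightarrow> random_variable borel X \<and>
     prob {\<omega> \<in> space M. X \<omega> = 1} = 1/2 \<and> prob {\<omega> \<in> space M. X \<omega> = -1} = 1/2"

definition (in prob_space) rademacher_vector :: "('a \<Rightarrow> real ^ 'd) \<Rightarrow> bool" where
  "rademacher_vector z \<longleftrightarrow>
     (\<forall>k. rademacher (\<lambda>\<omega>. z \<omega> $ k)) \<and> indep_vars (\<lambda>_. borel) (\<lambda>k \<omega>. z \<omega> $ k) UNIV"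

text \<open>The probes are indexed by \<open>1, \<dots>, N\<close>; values of \<open>z\<close> at other indices are irrelevant.\<close>

definition (in prob_space) rademacher_probes :: "nat \<Rightarrow> (nat \<Rightarrow> 'a \<Rightarrow> real ^ 'd) \<Rightarrow> bool" where
  "rademacher_probes N z \<longleftrightarrow>
     (\<forall>i\<in>{1..N}. rademacher_vector (z i)) \<and> indep_vars (\<lambda>_. borel) z {1..N}"

definition quad_form :: "real ^ 'd ^ 'd \<Rightarrow> real ^ 'd \<Rightarrow> real" where
  "quad_form A v = v \<bullet> (A *v v)"

definition hutchinson :: "real ^ 'd ^ 'd \<Rightarrow> nat \<Rightarrow> (nat \<Rightarrow> 'a \<Rightarrow> real ^ 'd) \<Rightarrow> 'a \<Rightarrow> real" where
  "hutchinson A N z \<omega> = 1 / real N * (\<Sum>i=1..N. quad_form A (z i \<omega>))"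

definition frobenius_norm :: "real ^ 'd ^ 'd \<Rightarrow> real" where
  "frobenius_norm A = sqrt (\<Sum>i\<in>UNIV. \<Sum>j\<in>UNIV. (A $ i $ j)\<^sup>2)"

lemma frobenius_norm_eq_norm: "frobenius_norm A = norm A"
  by (simp add: frobenius_norm_def norm_vec_def L2_set_def sum_nonneg)

definition (in prob_space) rel_std_error :: "('a \<Rightarrow> real) \<Rightarrow> real \<Rightarrow> real" where
  "rel_std_error X \<theta> = sqrt (variance X) / \<bar>\<theta>\<bar>"

end

theory Submission
  imports Defs
begin

text \<open>
  On sign vectors the diagonal of the quadratic form contributes exactly the trace, so the variance
  is the second moment of the off-diagonal part. A monomial in independent Rademacher variables has
  mean 1 if all exponents are even and 0 otherwise; expanding the square, only the terms pairing
  \<open>(i, j)\<close> with itself or with \<open>(j, i)\<close> survive, which by symmetry gives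
  the factor 2. Independence of the probes then yields the factor \<open>1 / N\<close>.
\<close>

context prob_space
begin

section \<open>Variance under scaling and for independent sums\<close>

lemma variance_cmult:
  fixes X :: "'a \<Rightarrow> real"
  shows "variance (\<lambda>\<omega>. c * X \<omega>) = c\<^sup>2 * variance X"
  by (simp flip: right_diff_distrib add: power_mult_distrib)

text \<open>Independence makes \<open>X * Y\<close> integrable and factors its mean, so the cross
  term cancels against the one in the squared mean of the sum.\<close>

lemma variance_add_indep:
  fixes X Y :: "'a \<Rightarrow> real"
  assumes indep: "indep_var borel X borel Y"
    and [simp]: "integrable M X" "integrable M (\<lambda>\<omega>. (X \<omega>)\<^sup>2)"
      "integrable M Y" "integrable M (\<lambda>\<omega>. (Y \<omega>)\<^sup>2)"
  shows "integrable M (\<lambda>\<omega>. (X \<omega> + Y \<omega>)\<^sup>2)"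
    and "variance (\<lambda>\<omega>. X \<omega> + Y \<omega>) = variance X + variance Y"
proof -
  have [simp]: "integrable M (\<lambda>\<omega>. X \<omega> * Y \<omega>)"
    using indep_var_integrable[OF indep] by simp
  have sq: "(\<lambda>\<omega>. (X \<omega> + Y \<omega>)\<^sup>2) = (\<lambda>\<omega>. (X \<omega>)\<^sup>2 + (Y \<omega>)\<^sup>2 + 2 * (X \<omega> * Y \<omega>))"
    by (simp add: power2_sum mult.assoc)
  show int: "integrable M (\<lambda>\<omega>. (X \<omega> + Y \<omega>)\<^sup>2)"
    unfolding sq by simp
  have "variance (\<lambda>\<omega>. X \<omega> + Y \<omega>) =
      expectation (\<lambda>\<omega>. (X \<omega> + Y \<omega>)\<^sup>2) - (expectation X + expectation Y)\<^sup>2"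
    by (subst variance_eq) (simp_all add: int)
  also have "expectation (\<lambda>\<omega>. (X \<omega> + Y \<omega>)\<^sup>2) = expectation (\<lambda>\<omega>. (X \<omega>)\<^sup>2)
      + expectation (\<lambda>\<omega>. (Y \<omega>)\<^sup>2) + 2 * (expectation X * expectation Y)"
    unfolding sq by (simp add: indep_var_lebesgue_integral[OF indep])
  finally show "variance (\<lambda>\<omega>. X \<omega> + Y \<omega>) = variance X + variance Y"
    by (simp add: variance_eq power2_sum)
qed

text \<open>Induction on the index set: the new summand is independent of the partial sum. Square
  integrability is part of the conclusion because the induction step needs it for the partial
  sum.\<close>

lemma variance_sum_indep:
  fixes X :: "'i \<Rightarrow> 'a \<Rightarrow> real"
  assumes "finite I" "indep_vars (\<lambda>_. borel) X I"
    and "\<And>i. i \<in> I \<Longrightarrow> integrable M (X i)"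
    and "\<And>i. i \<in> I \<Longrightarrow> integrable M (\<lambda>\<omega>. (X i \<omega>)\<^sup>2)"
  shows "integrable M (\<lambda>\<omega>. (\<Sum>i\<in>I. X i \<omega>)\<^sup>2) \<and>
    variance (\<lambda>\<omega>. \<Sum>i\<in>I. X i \<omega>) = (\<Sum>i\<in>I. variance (X i))"
  using assms
proof (induction I)
  case (insert i I)
  have IH: "integrable M (\<lambda>\<omega>. (\<Sum>i\<in>I. X i \<omega>)\<^sup>2)"
    "variance (\<lambda>\<omega>. \<Sum>i\<in>I. X i \<omega>) = (\<Sum>i\<in>I. variance (X i))"
    using insert.IH insert.prems indep_vars_subset[OF insert.prems(1), of I] by auto
  have "indep_var borel (X i) borel (\<lambda>\<omega>. \<Sum>i\<in>I. X i \<omega>)"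
    using insert.hyps insert.prems(1) by (rule indep_vars_sum)
  from variance_add_indep[OF this] IH insert.prems insert.hyps show ?case
    by simp
qed simp

section \<open>Moments of Rademacher variables and vectors\<close>

lemma rademacher_AE:
  assumes "rademacher X"
  shows "AE \<omega> in M. X \<omega> = 1 \<or> X \<omega> = -1"
proof -
  let ?A = "{\<omega> \<in> space M. X \<omega> = 1}" and ?B = "{\<omega> \<in> space M. X \<omega> = -1}"
  have [measurable]: "random_variable borel X"
    using assms by (simp add: rademacher_def)
  \<comment> \<open>The two events are disjoint and have probability 1/2 each.\<close>
  have "prob (?A \<union> ?B) = 1"
    using assms by (subst finite_measure_Union) (auto simp: rademacher_def)
  then have "AE \<omega> in M. \<omega> \<in> ?A \<union> ?B"
    by (rule AE_prob_1)
  then show ?thesis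
    by eventually_elim auto
qed

text \<open>Almost surely the power is bounded by 1 and equals a combination of the indicators of
  the events \<open>X = 1\<close> and \<open>X = -1\<close>; its mean is therefore
  \<open>(1 + (-1) ^ n) / 2\<close>.\<close>

lemma rademacher_expectation_power:
  assumes "rademacher X"
  shows "integrable M (\<lambda>\<omega>. X \<omega> ^ n)" and "expectation (\<lambda>\<omega>. X \<omega> ^ n) = of_bool (even n)"
proof -
  let ?A = "{\<omega> \<in> space M. X \<omega> = 1}" and ?B = "{\<omega> \<in> space M. X \<omega> = -1}"
  have [measurable]: "random_variable borel X"
    using assms by (simp add: rademacher_def)
  show "integrable M (\<lambda>\<omega>. X \<omega> ^ n)"
  proof (rule integrable_const_bound[where B = 1])
    show "AE \<omega> in M. norm (X \<omega> ^ n) \<le> 1"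
      using rademacher_AE[OF assms] by eventually_elim (auto simp: norm_power)
  qed simp
  have "expectation (\<lambda>\<omega>. X \<omega> ^ n) =
      expectation (\<lambda>\<omega>. indicator ?A \<omega> + (-1) ^ n * indicator ?B \<omega>)"
  proof (rule integral_cong_AE)
    show "AE \<omega> in M. X \<omega> ^ n = indicator ?A \<omega> + (-1) ^ n * indicator ?B \<omega>"
      using rademacher_AE[OF assms] AE_space by eventually_elim auto
  qed simp_all
  also have "\<dots> = prob ?A + (-1) ^ n * prob ?B"
  proof (subst Bochner_Integration.integral_add)
    show "integrable M (indicator ?A :: 'a \<Rightarrow> real)"
      "integrable M (\<lambda>\<omega>. (-1) ^ n * indicator ?B \<omega> :: real)"
      by (auto simp: less_top[symmetric])
    have "?A \<inter> space M = ?A" "?B \<inter> space M = ?B"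
      by auto
    then show "expectation (indicator ?A) + expectation (\<lambda>\<omega>. (-1) ^ n * indicator ?B \<omega>)
        = prob ?A + (-1) ^ n * prob ?B"
      by simp
  qed
  also have "\<dots> = of_bool (even n)"
    using assms by (auto simp: rademacher_def)
  finally show "expectation (\<lambda>\<omega>. X \<omega> ^ n) = of_bool (even n)" .
qed

text \<open>Independence factors the mean over the coordinates, and a single odd exponent gives a
  factor 0. Using an exponent function on the whole index type treats coinciding and distinct
  indices uniformly.\<close>

lemma rademacher_vector_monomial:
  fixes z :: "'a \<Rightarrow> real ^ 'd::finite"
  assumes "rademacher_vector z"
  shows "integrable M (\<lambda>\<omega>. \<Prod>a\<in>UNIV. (z \<omega> $ a) ^ n a)"
    and "expectation (\<lambda>\<omega>. \<Prod>a\<in>UNIV. (z \<omega> $ a) ^ n a) = of_bool (\<forall>a. even (n a))"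
proof -
  have rad: "rademacher (\<lambda>\<omega>. z \<omega> $ a)" for a
    using assms by (simp add: rademacher_vector_def)
  have indep: "indep_vars (\<lambda>_. borel) (\<lambda>a \<omega>. (z \<omega> $ a) ^ n a) UNIV"
    using indep_vars_compose2[of "\<lambda>_. borel" "\<lambda>a \<omega>. z \<omega> $ a" UNIV
        "\<lambda>a x. x ^ n a" "\<lambda>_. borel"] assms
    by (simp add: rademacher_vector_def)
  note int = rademacher_expectation_power(1)[OF rad]
  show "integrable M (\<lambda>\<omega>. \<Prod>a\<in>UNIV. (z \<omega> $ a) ^ n a)"
    by (rule indep_vars_integrable[OF finite indep int])
  show "expectation (\<lambda>\<omega>. \<Prod>a\<in>UNIV. (z \<omega> $ a) ^ n a) = of_bool (\<forall>a. even (n a))"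
    by (subst indep_vars_lebesgue_integral[OF finite indep int])
      (auto simp: rademacher_expectation_power(2)[OF rad] of_bool_def)
qed

end

text \<open>Writes one coordinate as a monomial whose exponent vector is an indicator, so that
  multiplying coordinates amounts to adding indicators.\<close>

lemma prod_power_of_bool:
  fixes v :: "real ^ 'd::finite"
  shows "(\<Prod>a\<in>UNIV. (v $ a) ^ of_bool (a = i)) = v $ i"
proof -
  have "(\<Prod>a\<in>UNIV. (v $ a) ^ of_bool (a = i)) = (\<Prod>a\<in>UNIV. if a = i then v $ a else 1)"
    by (rule prod.cong) auto
  then show ?thesis
    by simp
qed

context prob_space
begin

lemma rademacher_vector_moment2:
  fixes z :: "'a \<Rightarrow> real ^ 'd::finite"
  assumes z: "rademacher_vector z" and "i \<noteq> j"
  shows "integrable M (\<lambda>\<omega>. z \<omega> $ i * z \<omega> $ j)"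
    and "expectation (\<lambda>\<omega>. z \<omega> $ i * z \<omega> $ j) = 0"
proof -
  \<comment> \<open>\<open>n a\<close> counts the occurrences of \<open>a\<close> among
    \<open>i\<close> and \<open>j\<close>; as these differ, \<open>i\<close> has exponent 1.\<close>
  define n :: "'d \<Rightarrow> nat" where "n a = of_bool (a = i) + of_bool (a = j)" for a
  have "(\<Prod>a\<in>UNIV. (z \<omega> $ a) ^ n a) = z \<omega> $ i * z \<omega> $ j" for \<omega>
    by (simp add: n_def power_add prod.distrib prod_power_of_bool)
  moreover have "odd (n i)"
    using \<open>i \<noteq> j\<close> by (simp add: n_def)
  ultimately show "integrable M (\<lambda>\<omega>. z \<omega> $ i * z \<omega> $ j)"
    and "expectation (\<lambda>\<omega>. z \<omega> $ i * z \<omega> $ j) = 0"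
    using rademacher_vector_monomial[OF z, of n] by (auto simp: of_bool_def split: if_splits)
qed

text \<open>The exponent of a coordinate is its number of occurrences in the list \<open>i\<close>,
  \<open>j\<close>, \<open>k\<close>, \<open>l\<close>. No index repeats within a pair, so all
  exponents are even exactly when each index of one pair also occurs in the other.\<close>

lemma rademacher_vector_moment4:
  fixes z :: "'a \<Rightarrow> real ^ 'd::finite"
  assumes z: "rademacher_vector z" and "i \<noteq> j" "k \<noteq> l"
  shows "integrable M (\<lambda>\<omega>. z \<omega> $ i * z \<omega> $ j * (z \<omega> $ k * z \<omega> $ l))"
    and "expectation (\<lambda>\<omega>. z \<omega> $ i * z \<omega> $ j * (z \<omega> $ k * z \<omega> $ l)) = of_bool ({i, j} = {k, l})"
proof -
  define n :: "'d \<Rightarrow> nat" where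
    "n a = of_bool (a = i) + of_bool (a = j) + (of_bool (a = k) + of_bool (a = l))" for a
  have eq: "(\<Prod>a\<in>UNIV. (z \<omega> $ a) ^ n a) = z \<omega> $ i * z \<omega> $ j * (z \<omega> $ k * z \<omega> $ l)" for \<omega>
    by (simp add: n_def power_add prod.distrib prod_power_of_bool)
  \<comment> \<open>Parity at \<open>i\<close> and \<open>j\<close> suffices: each occurs once in
    the first pair, hence must occur in the second.\<close>
  have "{i, j} = {k, l}" if "\<forall>a. even (n a)"
    using that[rule_format, of i] that[rule_format, of j] assms(2,3)
    by (auto simp: n_def split: if_splits)
  moreover have "even (n a)" if "{i, j} = {k, l}" for a
    using that assms(2,3) by (auto simp: n_def doubleton_eq_iff)
  ultimately have par: "(\<forall>a. even (n a)) \<longleftrightarrow> {i, j} = {k, l}"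
    by blast
  show "integrable M (\<lambda>\<omega>. z \<omega> $ i * z \<omega> $ j * (z \<omega> $ k * z \<omega> $ l))"
    and "expectation (\<lambda>\<omega>. z \<omega> $ i * z \<omega> $ j * (z \<omega> $ k * z \<omega> $ l)) = of_bool ({i, j} = {k, l})"
    using rademacher_vector_monomial[OF z, of n] unfolding eq par by auto
qed

end

section \<open>The quadratic form and its off-diagonal part\<close>

lemma quad_form_eq_sum: "quad_form A v = (\<Sum>(i, j)\<in>UNIV. A $ i $ j * (v $ i * v $ j))"
  by (simp add: quad_form_def inner_vec_def matrix_vector_mult_def sum_distrib_left
      sum.cartesian_product mult_ac flip: UNIV_Times_UNIV)

lemma borel_measurable_quad_form [measurable]: "quad_form A \<in> borel_measurable borel"
  unfolding quad_form_eq_sum [abs_def] case_prod_beta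
  by (intro borel_measurable_continuous_onI continuous_intros)

definition offdiag_form :: "real ^ 'd ^ 'd \<Rightarrow> real ^ 'd::finite \<Rightarrow> real" where
  "offdiag_form A v = (\<Sum>(i, j)\<in>{(i, j). i \<noteq> j}. A $ i $ j * (v $ i * v $ j))"

lemma quad_form_sign_vector:
  fixes A :: "real ^ 'd ^ 'd"
  assumes "\<forall>k. v $ k = 1 \<or> v $ k = -1"
  shows "quad_form A v = trace A + offdiag_form A v"
proof -
  have one: "v $ k * v $ k = 1" for k
    using assms[rule_format, of k] by auto
  have split: "(UNIV :: ('d \<times> 'd) set) = {(i, j). i = j} \<union> {(i, j). i \<noteq> j}"
    by auto
  have "quad_form A v = (\<Sum>(i, j)\<in>{(i, j). i = j}. A $ i $ j * (v $ i * v $ j)) + offdiag_form A v"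
    unfolding quad_form_eq_sum split offdiag_form_def by (rule sum.union_disjoint) auto
  also have "(\<Sum>(i, j)\<in>{(i, j). i = j}. A $ i $ j * (v $ i * v $ j)) = trace A"
    \<comment> \<open>The diagonal is reindexed by its common coordinate, and \<open>one\<close>
      removes the squared entry.\<close>
    unfolding trace_def
    by (rule sum.reindex_bij_witness[where i = "\<lambda>i. (i, i)" and j = fst]) (auto simp: one)
  finally show ?thesis .
qed

section \<open>Variance of the quadratic form and of the estimator\<close>

context prob_space
begin

lemma offdiag_form_moments:
  fixes z :: "'a \<Rightarrow> real ^ 'd::finite"
  assumes z: "rademacher_vector z" and sym: "transpose A = A"
  shows "integrable M (\<lambda>\<omega>. offdiag_form A (z \<omega>))"
    and "expectation (\<lambda>\<omega>. offdiag_form A (z \<omega>)) = 0"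
    and "integrable M (\<lambda>\<omega>. (offdiag_form A (z \<omega>))\<^sup>2)"
    and "expectation (\<lambda>\<omega>. (offdiag_form A (z \<omega>))\<^sup>2) = 2 * (\<Sum>(i, j)\<in>{(i, j). i \<noteq> j}. (A $ i $ j)\<^sup>2)"
proof -
  let ?O = "{(i, j). i \<noteq> j} :: ('d \<times> 'd) set"
  \<comment> \<open>With ordered pairs as single indices, the squared form becomes a double sum
    weighted by the products \<open>y p * y q\<close>, whose means are the fourth moments.\<close>
  define m where "m p = A $ fst p $ snd p" for p :: "'d \<times> 'd"
  define y where "y p \<omega> = z \<omega> $ fst p * z \<omega> $ snd p" for p :: "'d \<times> 'd" and \<omega>
  have S: "offdiag_form A (z \<omega>) = (\<Sum>p\<in>?O. m p * y p \<omega>)" for \<omega>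
    by (simp add: offdiag_form_def m_def y_def case_prod_beta)
  have y1: "integrable M (y p)" "expectation (y p) = 0" if "p \<in> ?O" for p
    using that rademacher_vector_moment2[OF z, of "fst p" "snd p"] by (auto simp: y_def [abs_def])
  \<comment> \<open>Equality of the underlying unordered pairs leaves two choices of
    \<open>q\<close>: the pair \<open>p\<close> and its swap.\<close>
  have y2: "integrable M (\<lambda>\<omega>. y p \<omega> * y q \<omega>)"
    "expectation (\<lambda>\<omega>. y p \<omega> * y q \<omega>) = of_bool (q = p \<or> q = prod.swap p)"
    if "p \<in> ?O" "q \<in> ?O" for p q
    using that rademacher_vector_moment4[OF z, of "fst p" "snd p" "fst q" "snd q"]
    by (auto simp: y_def [abs_def] doubleton_eq_iff prod_eq_iff of_bool_def split: if_splits)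
  show "integrable M (\<lambda>\<omega>. offdiag_form A (z \<omega>))" "expectation (\<lambda>\<omega>. offdiag_form A (z \<omega>)) = 0"
    unfolding S
    by (auto intro!: Bochner_Integration.integrable_sum integrable_mult_right y1)
      (subst Bochner_Integration.integral_sum, use y1 in force, simp add: y1)
  have SS: "(offdiag_form A (z \<omega>))\<^sup>2 = (\<Sum>p\<in>?O. \<Sum>q\<in>?O. m p * m q * (y p \<omega> * y q \<omega>))" for \<omega>
    unfolding S power2_eq_square sum_product by (simp add: mult_ac)
  have "(\<Sum>p\<in>?O. \<Sum>q\<in>?O. m p * m q * of_bool (q = p \<or> q = prod.swap p)) =
      (\<Sum>p\<in>?O. 2 * (m p)\<^sup>2)"
  proof (rule sum.cong[OF refl])
    fix p assume p: "p \<in> ?O"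
    have swap: "m (prod.swap p) = m p"
      using arg_cong[OF sym, of "\<lambda>B. B $ fst p $ snd p"] by (simp add: m_def transpose_def)
    \<comment> \<open>Off the diagonal, \<open>p\<close> and its swap are distinct, so exactly two
      terms remain; by symmetry of \<open>A\<close> they are equal.\<close>
    have "(\<Sum>q\<in>?O. m p * m q * of_bool (q = p \<or> q = prod.swap p)) =
        (\<Sum>q\<in>{p, prod.swap p}. m p * m q)"
      using p by (intro sum.mono_neutral_cong_right) auto
    also have "\<dots> = 2 * (m p)\<^sup>2"
      using p swap by (auto simp: power2_eq_square prod_eq_iff)
    finally show "(\<Sum>q\<in>?O. m p * m q * of_bool (q = p \<or> q = prod.swap p)) = 2 * (m p)\<^sup>2" .
  qed
  then have sum_eq: "(\<Sum>p\<in>?O. \<Sum>q\<in>?O. m p * m q * of_bool (q = p \<or> q = prod.swap p)) =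
      2 * (\<Sum>(i, j)\<in>?O. (A $ i $ j)\<^sup>2)"
    by (simp add: m_def case_prod_beta sum_distrib_left)
  \<comment> \<open>This predicate carries integrability and value through the double sum
    together.\<close>
  have "has_bochner_integral M (\<lambda>\<omega>. (offdiag_form A (z \<omega>))\<^sup>2)
      (\<Sum>p\<in>?O. \<Sum>q\<in>?O. m p * m q * of_bool (q = p \<or> q = prod.swap p))"
    unfolding SS
  proof (intro has_bochner_integral_sum has_bochner_integral_mult_right)
    fix p q assume "p \<in> ?O" "q \<in> ?O"
    with y2[OF this]
    show "has_bochner_integral M (\<lambda>\<omega>. y p \<omega> * y q \<omega>) (of_bool (q = p \<or> q = prod.swap p))"
      by (simp only: has_bochner_integral_iff)
  qed
  then show "integrable M (\<lambda>\<omega>. (offdiag_form A (z \<omega>))\<^sup>2)"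
    and "expectation (\<lambda>\<omega>. (offdiag_form A (z \<omega>))\<^sup>2) = 2 * (\<Sum>(i, j)\<in>?O. (A $ i $ j)\<^sup>2)"
    unfolding has_bochner_integral_iff sum_eq by auto
qed

text \<open>Measurability into a Euclidean space can be tested on basis vectors, and each of these
  picks out one coordinate.\<close>

lemma rademacher_vector_measurable:
  fixes z :: "'a \<Rightarrow> real ^ 'd::finite"
  assumes "rademacher_vector z"
  shows "random_variable borel z"
proof (subst borel_measurable_euclidean_space, intro ballI)
  fix b :: "real ^ 'd" assume "b \<in> Basis"
  then obtain k where b: "b = axis k 1"
    by (auto simp: Basis_vec_def)
  show "random_variable borel (\<lambda>\<omega>. z \<omega> \<bullet> b)"
    using assms by (simp add: b inner_axis rademacher_vector_def rademacher_def)
qed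

text \<open>The form agrees almost surely with the trace plus a centred off-diagonal part, so
  integrability transfers from that part, and the deviation from the mean is that part
  itself.\<close>

lemma variance_quad_form:
  fixes z :: "'a \<Rightarrow> real ^ 'd::finite"
  assumes z: "rademacher_vector z" and sym: "transpose A = A"
  shows "integrable M (\<lambda>\<omega>. quad_form A (z \<omega>))"
    and "integrable M (\<lambda>\<omega>. (quad_form A (z \<omega>))\<^sup>2)"
    and "variance (\<lambda>\<omega>. quad_form A (z \<omega>)) = 2 * (\<Sum>(i, j)\<in>{(i, j). i \<noteq> j}. (A $ i $ j)\<^sup>2)"
proof -
  let ?S = "\<lambda>\<omega>. offdiag_form A (z \<omega>)" and ?Q = "\<lambda>\<omega>. quad_form A (z \<omega>)"
  note [measurable] = rademacher_vector_measurable[OF z]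
  note S = offdiag_form_moments[OF z sym]
  note [measurable] = borel_measurable_integrable[OF S(1)]
  \<comment> \<open>The quantifier over \<open>k\<close> moves inside because there are only
    finitely many coordinates.\<close>
  have "AE \<omega> in M. \<forall>k. z \<omega> $ k = 1 \<or> z \<omega> $ k = -1"
    using z by (simp add: AE_all_countable rademacher_vector_def rademacher_AE)
  then have eq: "AE \<omega> in M. ?Q \<omega> = trace A + ?S \<omega>"
    by eventually_elim (rule quad_form_sign_vector)
  have "integrable M (\<lambda>\<omega>. trace A + ?S \<omega>)"
    by (simp add: S)
  then show "integrable M ?Q"
    by (subst integrable_cong_AE[OF _ _ eq]) simp_all
  have "integrable M (\<lambda>\<omega>. (trace A + ?S \<omega>)\<^sup>2)"
    by (simp add: S power2_sum)
  moreover have "AE \<omega> in M. (?Q \<omega>)\<^sup>2 = (trace A + ?S \<omega>)\<^sup>2"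
    using eq by eventually_elim simp
  ultimately show "integrable M (\<lambda>\<omega>. (?Q \<omega>)\<^sup>2)"
    by (subst integrable_cong_AE) simp_all
  have mean: "expectation ?Q = trace A"
    by (subst integral_cong_AE[OF _ _ eq]) (simp_all add: S prob_space)
  have "variance ?Q = expectation (\<lambda>\<omega>. (?S \<omega>)\<^sup>2)"
    unfolding mean by (rule integral_cong_AE) (use eq in \<open>auto elim: eventually_mono\<close>)
  then show "variance ?Q = 2 * (\<Sum>(i, j)\<in>{(i, j). i \<noteq> j}. (A $ i $ j)\<^sup>2)"
    by (simp add: S)
qed

text \<open>The \<open>N\<close> independent terms have equal variance, giving a factor
  \<open>N\<close>, and averaging gives \<open>1 / N^2\<close>. At \<open>N = 0\<close> both sides
  are 0 by the convention for division by zero.\<close>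

lemma variance_hutchinson:
  fixes z :: "nat \<Rightarrow> 'a \<Rightarrow> real ^ 'd::finite"
  assumes z: "rademacher_probes N z" and sym: "transpose A = A"
  shows "variance (hutchinson A N z) =
    2 / real N * (\<Sum>(i, j)\<in>{(i, j). i \<noteq> j}. (A $ i $ j)\<^sup>2)"
proof -
  let ?s = "\<Sum>(i, j)\<in>{(i, j). i \<noteq> j}. (A $ i $ j)\<^sup>2"
  have zi: "rademacher_vector (z i)" if "i \<in> {1..N}" for i
    using z that by (auto simp: rademacher_probes_def)
  have "indep_vars (\<lambda>_. borel) (\<lambda>i \<omega>. quad_form A (z i \<omega>)) {1..N}"
    using indep_vars_compose2[of "\<lambda>_. borel" z "{1..N}"
        "\<lambda>_. quad_form A" "\<lambda>_. borel"] z
    by (simp add: rademacher_probes_def)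
  then have "variance (\<lambda>\<omega>. \<Sum>i=1..N. quad_form A (z i \<omega>)) =
      (\<Sum>i=1..N. variance (\<lambda>\<omega>. quad_form A (z i \<omega>)))"
    by (intro variance_sum_indep[THEN conjunct2] variance_quad_form[OF zi sym]) auto
  also have "\<dots> = real N * (2 * ?s)"
    using variance_quad_form(3)[OF zi sym] by simp
  finally have "variance (\<lambda>\<omega>. 1 / real N * (\<Sum>i=1..N. quad_form A (z i \<omega>))) =
      (1 / real N)\<^sup>2 * (real N * (2 * ?s))"
    by (simp only: variance_cmult)
  then show ?thesis
    by (simp add: hutchinson_def [abs_def] power2_eq_square)
qed

text \<open>Standard deviation and target scale by the same factor, so the normalisation by the
  dimension cancels.\<close>

lemma rel_std_error_divide:
  assumes "c \<noteq> 0"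
  shows "rel_std_error (\<lambda>\<omega>. X \<omega> / c) (\<theta> / c) = rel_std_error X \<theta>"
  using assms variance_cmult[of "1 / c" X]
  by (simp add: rel_std_error_def real_sqrt_divide power_divide)

end

section \<open>Transfer between equal laws, the Frobenius bound and the final assembly\<close>

lemma variance_eq_of_distr_eq:
  fixes f :: "'c::topological_space \<Rightarrow> real"
  assumes "distr Q borel w = distr P borel z" "w \<in> borel_measurable Q" "z \<in> borel_measurable P"
    and [measurable]: "f \<in> borel_measurable borel"
    and "prob_space P" "prob_space Q"
  shows "prob_space.variance Q (\<lambda>\<omega>. f (w \<omega>)) = prob_space.variance P (\<lambda>\<omega>. f (z \<omega>))"
proof -
  have E: "integral\<^sup>L Q (\<lambda>\<omega>. g (w \<omega>)) = integral\<^sup>L P (\<lambda>\<omega>. g (z \<omega>))"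
    if "g \<in> borel_measurable borel" for g :: "'c \<Rightarrow> real"
    using integral_distr[OF assms(2) that] integral_distr[OF assms(3) that] assms(1) by simp
  show ?thesis
    \<comment> \<open>\<open>E\<close> serves twice: for \<open>f\<close>, to identify the two
      means, and for the squared deviation from that common mean.\<close>
    using E[of "\<lambda>x. (f x - integral\<^sup>L P (\<lambda>\<omega>. f (z \<omega>)))\<^sup>2"] by (simp add: E)
qed

lemma offdiag_sum_le_frobenius:
  "(\<Sum>(i, j)\<in>{(i, j). i \<noteq> j}. (A $ i $ j)\<^sup>2) \<le> (frobenius_norm A)\<^sup>2"
proof -
  have "(\<Sum>(i, j)\<in>{(i, j). i \<noteq> j}. (A $ i $ j)\<^sup>2) \<le> (\<Sum>(i, j)\<in>UNIV. (A $ i $ j)\<^sup>2)"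
    by (rule sum_mono2) auto
  also have "\<dots> = (frobenius_norm A)\<^sup>2"
    by (simp add: frobenius_norm_def sum_nonneg sum.cartesian_product case_prod_beta)
  finally show ?thesis .
qed

theorem corollary6p2:
  fixes M :: "real ^ 'd ^ 'd"
  assumes symmetric: "transpose M = M"
  shows
    "(\<forall>(P :: 'a measure) (N :: nat) (z :: nat \<Rightarrow> 'a \<Rightarrow> real ^ 'd)
       (Q :: 'b measure) (w :: 'b \<Rightarrow> real ^ 'd).
        prob_space P \<longrightarrow> N \<ge> 1 \<longrightarrow> prob_space.rademacher_probes P N z \<longrightarrow>
        prob_space Q \<longrightarrow> w \<in> borel_measurable Q \<longrightarrow>
        (\<forall>i\<in>{1..N}. distr Q borel w = distr P borel (z i)) \<longrightarrow>
          prob_space.variance P (hutchinson M N z)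
            = 1 / real N * prob_space.variance Q (\<lambda>\<omega>. quad_form M (w \<omega>)) \<and>
          1 / real N * prob_space.variance Q (\<lambda>\<omega>. quad_form M (w \<omega>))
            = 2 / real N * (\<Sum>(i, j)\<in>{(i, j). i \<noteq> j}. (M $ i $ j)\<^sup>2) \<and>
          2 / real N * (\<Sum>(i, j)\<in>{(i, j). i \<noteq> j}. (M $ i $ j)\<^sup>2)
            \<le> 2 * (frobenius_norm M)\<^sup>2 / real N)
     \<and>
     (trace M \<noteq> 0 \<longrightarrow>
       (\<forall>(P :: nat \<Rightarrow> 'c measure) (z :: nat \<Rightarrow> nat \<Rightarrow> 'c \<Rightarrow> real ^ 'd).
         (\<forall>N\<ge>1. prob_space (P N) \<and> prob_space.rademacher_probes (P N) N (z N)) \<longrightarrow>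
         (\<lambda>N. prob_space.rel_std_error (P N)
                 (\<lambda>\<omega>. hutchinson M N (z N) \<omega> / real CARD('d)) (trace M / real CARD('d)))
           \<in> O(\<lambda>N. 1 / sqrt (real N))))"
proof (intro conjI impI allI)
  fix P :: "'a measure" and N :: nat and z :: "nat \<Rightarrow> 'a \<Rightarrow> real ^ 'd"
    and Q :: "'b measure" and w :: "'b \<Rightarrow> real ^ 'd"
  assume P: "prob_space P" and N: "N \<ge> 1" and z: "prob_space.rademacher_probes P N z"
    and Q: "prob_space Q" and w: "w \<in> borel_measurable Q"
    and dist: "\<forall>i\<in>{1..N}. distr Q borel w = distr P borel (z i)"
  let ?s = "\<Sum>(i, j)\<in>{(i, j). i \<noteq> j}. (M $ i $ j)\<^sup>2"
  \<comment> \<open>Since \<open>N\<close> is at least 1, the first probe exists and can represent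
    the law of \<open>w\<close>.\<close>
  have z1: "prob_space.rademacher_vector P (z 1)"
    using z N by (simp add: prob_space.rademacher_probes_def[OF P])
  have "prob_space.variance Q (\<lambda>\<omega>. quad_form M (w \<omega>)) =
      prob_space.variance P (\<lambda>\<omega>. quad_form M (z 1 \<omega>))"
    using dist N w P Q prob_space.rademacher_vector_measurable[OF P z1]
    by (intro variance_eq_of_distr_eq) auto
  then have V: "prob_space.variance Q (\<lambda>\<omega>. quad_form M (w \<omega>)) = 2 * ?s"
    by (simp only: prob_space.variance_quad_form(3)[OF P z1 symmetric])
  show "1 / real N * prob_space.variance Q (\<lambda>\<omega>. quad_form M (w \<omega>)) = 2 / real N * ?s"
    by (simp add: V)
  then show "prob_space.variance P (hutchinson M N z) =
      1 / real N * prob_space.variance Q (\<lambda>\<omega>. quad_form M (w \<omega>))"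
    by (simp only: prob_space.variance_hutchinson[OF P z symmetric])
  show "2 / real N * ?s \<le> 2 * (frobenius_norm M)\<^sup>2 / real N"
    using offdiag_sum_le_frobenius[of M] by (simp add: divide_right_mono)
next
  fix P :: "nat \<Rightarrow> 'c measure" and z :: "nat \<Rightarrow> nat \<Rightarrow> 'c \<Rightarrow> real ^ 'd"
  assume Pz: "\<forall>N\<ge>1. prob_space (P N) \<and> prob_space.rademacher_probes (P N) N (z N)"
  let ?s = "\<Sum>(i, j)\<in>{(i, j). i \<noteq> j}. (M $ i $ j)\<^sup>2"
  let ?e = "\<lambda>N. prob_space.rel_std_error (P N)
    (\<lambda>\<omega>. hutchinson M N (z N) \<omega> / real CARD('d)) (trace M / real CARD('d))"
  \<comment> \<open>The error is computed exactly. Its constant depends on \<open>M\<close> alone,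
    although the probability space and the probes may change with \<open>N\<close>.\<close>
  have "?e N = sqrt (2 * ?s) / \<bar>trace M\<bar> * (1 / sqrt (real N))" if "N \<ge> 1" for N
  proof -
    interpret prob_space "P N"
      using Pz that by simp
    have z: "rademacher_probes N (z N)"
      using Pz that by simp
    have "?e N = rel_std_error (hutchinson M N (z N)) (trace M)"
      by (rule rel_std_error_divide) simp
    also have "\<dots> = sqrt (2 / real N * ?s) / \<bar>trace M\<bar>"
      by (simp only: rel_std_error_def variance_hutchinson[OF z symmetric])
    also have "\<dots> = sqrt (2 * ?s) / \<bar>trace M\<bar> * (1 / sqrt (real N))"
      by (simp add: real_sqrt_divide real_sqrt_mult)
    finally show ?thesis .
  qed
  then have e: "norm (?e N) \<le> sqrt (2 * ?s) / \<bar>trace M\<bar> * norm (1 / sqrt (real N))" if "N \<ge> 1" for N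
    using that by (simp only: real_norm_def abs_mult abs_divide abs_abs)
      (simp add: sum_nonneg case_prod_beta)
  show "?e \<in> O(\<lambda>N. 1 / sqrt (real N))"
    \<comment> \<open>The probe assumptions start at \<open>N = 1\<close>, and an eventual bound is
      enough.\<close>
    using eventually_ge_at_top[of 1] by (rule bigoI[OF eventually_mono]) (rule e)
qed

end
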